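(* Let $\{N_\gamma\}_{\gamma\in\Gamma}$ be an uncountable almost disjoint family of infinite subsets of $\omega$ and let $$\mathrm{JL}_\infty=\overline{\mathrm{span}}^{\|\cdot\|_\infty}\bigl(c_0\cup\{\mathbf{1}_{N_\gamma}\colon\gamma\in\Gamma\}\bigr)\subset\ell_\infty .$$ Then $\mathrm{Ext}(c_0(\omega_1),\mathrm{JL}_\infty)\neq 0$.
   Context: All Banach spaces are real. A family of sets is almost disjoint if distinct members have finite intersection. For Banach spaces $X,Y$, $\mathrm{Ext}(X,Y)=0$ means that every short exact sequence $0\to Y\overset{i}{\to} Z\overset{q}{\to} X\to 0$ of Banach spaces and bounded operators splits, i.e. $i(Y)$ is complemented in $Z$; $\mathrm{Ext}(X,Y)\neq 0$ means that there exists a non-splitting such sequence. *)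

theory Defs
  imports "HOL-Analysis.Analysis"
begin

section \<open>Banach spaces on a carrier set\<close>

text \<open>
  The middle term of a short exact sequence is quantified over, so Banach spaces are needed as
  values rather than as types of class \<^class>\<open>banach\<close>.
\<close>

record 'a normed_structure =
  points :: "'a set"
  vadd :: "'a \<Rightarrow> 'a \<Rightarrow> 'a"
  vzero :: 'a
  vscale :: "real \<Rightarrow> 'a \<Rightarrow> 'a"
  vnorm :: "'a \<Rightarrow> real"

definition vdist :: "('a, 'm) normed_structure_scheme \<Rightarrow> 'a \<Rightarrow> 'a \<Rightarrow> real" where
  "vdist V x y = vnorm V (vadd V x (vscale V (-1) y))"

locale banach_structure =
  fixes V :: "('a, 'm) normed_structure_scheme"
  assumes add_closed: "\<lbrakk>x \<in> points V; y \<in> points V\<rbrakk> \<Longrightarrow> vadd V x y \<in> points V"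
    and zero_closed: "vzero V \<in> points V"
    and scale_closed: "x \<in> points V \<Longrightarrow> vscale V a x \<in> points V"
    and add_assoc: "\<lbrakk>x \<in> points V; y \<in> points V; z \<in> points V\<rbrakk>
      \<Longrightarrow> vadd V (vadd V x y) z = vadd V x (vadd V y z)"
    and add_commute: "\<lbrakk>x \<in> points V; y \<in> points V\<rbrakk> \<Longrightarrow> vadd V x y = vadd V y x"
    and add_zero: "x \<in> points V \<Longrightarrow> vadd V x (vzero V) = x"
    and add_neg: "x \<in> points V \<Longrightarrow> vadd V x (vscale V (-1) x) = vzero V"
    and scale_add_right: "\<lbrakk>x \<in> points V; y \<in> points V\<rbrakk>
      \<Longrightarrow> vscale V a (vadd V x y) = vadd V (vscale V a x) (vscale V a y)"
    and scale_add_left: "x \<in> points V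
      \<Longrightarrow> vscale V (a + b) x = vadd V (vscale V a x) (vscale V b x)"
    and scale_scale: "x \<in> points V \<Longrightarrow> vscale V a (vscale V b x) = vscale V (a * b) x"
    and scale_one: "x \<in> points V \<Longrightarrow> vscale V 1 x = x"
    and norm_eq_zero: "x \<in> points V \<Longrightarrow> vnorm V x = 0 \<longleftrightarrow> x = vzero V"
    and norm_scale: "x \<in> points V \<Longrightarrow> vnorm V (vscale V a x) = \<bar>a\<bar> * vnorm V x"
    and norm_triangle: "\<lbrakk>x \<in> points V; y \<in> points V\<rbrakk>
      \<Longrightarrow> vnorm V (vadd V x y) \<le> vnorm V x + vnorm V y"
    and complete: "\<lbrakk>range u \<subseteq> points V;
        \<forall>e>0. \<exists>N. \<forall>m\<ge>N. \<forall>n\<ge>N. vdist V (u m) (u n) < e\<rbrakk>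
      \<Longrightarrow> \<exists>x\<in>points V. (\<lambda>n. vdist V (u n) x) \<longlonglongrightarrow> 0"

definition of_subspace :: "'a::real_normed_vector set \<Rightarrow> 'a normed_structure" where
  "of_subspace S = \<lparr>points = S, vadd = (+), vzero = 0, vscale = scaleR, vnorm = norm\<rparr>"

lemma banach_structure_of_subspace:
  fixes S :: "'a::real_normed_vector set"
  assumes "subspace S" "complete S"
  shows "banach_structure (of_subspace S)"
proof
  fix u :: "nat \<Rightarrow> 'a"
  assume u: "range u \<subseteq> points (of_subspace S)"
    and "\<forall>e>0. \<exists>N. \<forall>m\<ge>N. \<forall>n\<ge>N. vdist (of_subspace S) (u m) (u n) < e"
  then have "Cauchy u"
    by (auto simp: Cauchy_def vdist_def of_subspace_def dist_norm)
  then obtain x where "x \<in> S" "u \<longlonglongrightarrow> x"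
    using assms(2) u unfolding complete_def of_subspace_def by (auto simp: image_subset_iff)
  then show "\<exists>x\<in>points (of_subspace S). (\<lambda>n. vdist (of_subspace S) (u n) x) \<longlonglongrightarrow> 0"
    by (auto simp: vdist_def of_subspace_def tendsto_norm_zero_iff LIM_zero_iff)
qed (use assms in \<open>auto simp: of_subspace_def algebra_simps subspace_add subspace_0 subspace_scale
  norm_triangle_ineq\<close>)


section \<open>Operators, complemented subspaces and extensions\<close>

text \<open>Only the values of an operator on the carrier of its domain matter.\<close>

definition bounded_operator ::
  "('a, 'm) normed_structure_scheme \<Rightarrow> ('b, 'n) normed_structure_scheme \<Rightarrow> ('a \<Rightarrow> 'b) \<Rightarrow> bool" where
  "bounded_operator V W T \<longleftrightarrow>
     T ` points V \<subseteq> points W \<and>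
     (\<forall>x\<in>points V. \<forall>y\<in>points V. T (vadd V x y) = vadd W (T x) (T y)) \<and>
     (\<forall>a. \<forall>x\<in>points V. T (vscale V a x) = vscale W a (T x)) \<and>
     (\<exists>C. \<forall>x\<in>points V. vnorm W (T x) \<le> C * vnorm V x)"

definition complemented :: "('a, 'm) normed_structure_scheme \<Rightarrow> 'a set \<Rightarrow> bool" where
  "complemented V M \<longleftrightarrow>
     (\<exists>P. bounded_operator V V P \<and> (\<forall>x\<in>points V. P (P x) = P x) \<and> P ` points V = M)"

definition short_exact ::
  "('b, 'n) normed_structure_scheme \<Rightarrow> ('b \<Rightarrow> 'c) \<Rightarrow> ('c, 'k) normed_structure_scheme \<Rightarrow>
   ('c \<Rightarrow> 'a) \<Rightarrow> ('a, 'm) normed_structure_scheme \<Rightarrow> bool" where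
  "short_exact Y i Z q X \<longleftrightarrow>
     bounded_operator Y Z i \<and> bounded_operator Z X q \<and>
     inj_on i (points Y) \<and>
     i ` points Y = {z \<in> points Z. q z = vzero X} \<and>
     q ` points Z = points X"

text \<open>
  HOL cannot quantify over types inside a formula, so the carrier of \<open>Z\<close> is taken in a fixed type.
  This loses nothing: a set-theoretic section of \<open>q\<close> embeds the carrier of any extension \<open>Z\<close>
  into \<^typ>\<open>'a \<times> 'b\<close>; see \<open>Ext_zero_complemented\<close> below.
\<close>

definition Ext_zero ::
  "('a, 'm) normed_structure_scheme \<Rightarrow> ('b, 'n) normed_structure_scheme \<Rightarrow> bool" where
  "Ext_zero X Y \<longleftrightarrow>
     (\<forall>(Z :: ('a \<times> 'b) normed_structure) i q.
        banach_structure Z \<and> short_exact Y i Z q X \<longrightarrow> complemented Z (i ` points Y))"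

lemma (in banach_structure) add_diff_cancel:
  assumes "x \<in> points V" "y \<in> points V"
  shows "vadd V (vadd V x (vscale V (-1) y)) y = x"
  by (metis assms add_assoc add_commute add_neg add_zero scale_closed)

lemma short_exact_carrier_embeds:
  fixes X :: "('a, 'm) normed_structure_scheme" and Y :: "('b, 'n) normed_structure_scheme"
    and Z :: "('c, 'k) normed_structure_scheme"
  assumes X: "banach_structure X" and Z: "banach_structure Z" and ex: "short_exact Y i Z q X"
  shows "\<exists>f :: 'c \<Rightarrow> 'a \<times> 'b. inj_on f (points Z)"
proof -
  interpret X: banach_structure X by (fact X)
  interpret Z: banach_structure Z by (fact Z)
  define s where "s = inv_into (points Z) q"
  define g where "g z = vadd Z z (vscale Z (-1) (s (q z)))" for z
  define f where "f z = (q z, inv_into (points Y) i (g z))" for z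
  have q: "q z \<in> points X" "s (q z) \<in> points Z" "q (s (q z)) = q z" if "z \<in> points Z" for z
    using that ex by (auto simp: short_exact_def s_def inv_into_into f_inv_into_f)
  have g: "g z \<in> i ` points Y" if z: "z \<in> points Z" for z
  proof -
    have "q (g z) = vadd X (q z) (vscale X (-1) (q z))"
      using ex q[OF z] z Z.scale_closed
      by (simp add: short_exact_def bounded_operator_def g_def)
    then have "q (g z) = vzero X"
      using q[OF z] X.add_neg by simp
    moreover have "g z \<in> points Z"
      using q[OF z] z Z.scale_closed Z.add_closed by (simp add: g_def)
    ultimately show ?thesis
      using ex by (simp add: short_exact_def)
  qed
  have "inj_on f (points Z)"
  proof (rule inj_onI)
    fix z w assume zw: "z \<in> points Z" "w \<in> points Z" "f z = f w"
    then have "q z = q w" and "g z = g w"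
      using g by (auto simp: f_def dest: inv_into_injective)
    then show "z = w"
      using Z.add_diff_cancel q zw unfolding g_def by metis
  qed
  then show ?thesis by blast
qed

definition transport :: "('a \<Rightarrow> 'b) \<Rightarrow> ('a, 'm) normed_structure_scheme \<Rightarrow> 'b normed_structure" where
  "transport f V = (let h = inv_into (points V) f in
     \<lparr>points = f ` points V, vadd = (\<lambda>x y. f (vadd V (h x) (h y))), vzero = f (vzero V),
      vscale = (\<lambda>a x. f (vscale V a (h x))), vnorm = (\<lambda>x. vnorm V (h x))\<rparr>)"

context banach_structure
begin

context
  fixes f :: "'a \<Rightarrow> 'b"
  assumes inj: "inj_on f (points V)"
begin

lemma transport_simps:
  "points (transport f V) = f ` points V"
  "vzero (transport f V) = f (vzero V)"
  "\<lbrakk>x \<in> points V; y \<in> points V\<rbrakk> \<Longrightarrow> vadd (transport f V) (f x) (f y) = f (vadd V x y)"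
  "x \<in> points V \<Longrightarrow> vscale (transport f V) a (f x) = f (vscale V a x)"
  "x \<in> points V \<Longrightarrow> vnorm (transport f V) (f x) = vnorm V x"
  using inj by (auto simp: transport_def Let_def inv_into_f_f)

lemma transport_vdist:
  "\<lbrakk>x \<in> points V; y \<in> points V\<rbrakk> \<Longrightarrow> vdist (transport f V) (f x) (f y) = vdist V x y"
  by (simp add: vdist_def transport_simps add_closed scale_closed)

lemma banach_structure_transport: "banach_structure (transport f V)"
proof
  fix u :: "nat \<Rightarrow> 'b"
  assume u: "range u \<subseteq> points (transport f V)"
    and C: "\<forall>e>0. \<exists>N. \<forall>m\<ge>N. \<forall>n\<ge>N. vdist (transport f V) (u m) (u n) < e"
  have "\<forall>n. \<exists>x. x \<in> points V \<and> u n = f x"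
    using u by (auto simp: transport_simps image_iff subset_iff)
  then obtain v where v: "\<And>n. v n \<in> points V" "\<And>n. u n = f (v n)"
    by metis
  then obtain x where "x \<in> points V" "(\<lambda>n. vdist V (v n) x) \<longlonglongrightarrow> 0"
    using complete[of v] C by (auto simp: transport_vdist)
  then show "\<exists>x\<in>points (transport f V). (\<lambda>n. vdist (transport f V) (u n) x) \<longlonglongrightarrow> 0"
    using v by (auto simp: transport_simps transport_vdist)
qed (auto simp: transport_simps add_closed zero_closed scale_closed add_assoc add_zero add_neg
  scale_add_right scale_add_left scale_scale scale_one norm_eq_zero norm_scale norm_triangle
  inj_on_eq_iff[OF inj] intro: add_commute)

end

end

lemma Ext_zero_complemented:
  fixes X :: "('a, 'm) normed_structure_scheme" and Y :: "('b, 'n) normed_structure_scheme"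
    and Z :: "('c, 'k) normed_structure_scheme"
  assumes X: "banach_structure X" and Z: "banach_structure Z" and ex: "short_exact Y i Z q X"
    and Ext: "Ext_zero X Y"
  shows "complemented Z (i ` points Y)"
proof -
  interpret Z: banach_structure Z by (fact Z)
  obtain f :: "'c \<Rightarrow> 'a \<times> 'b" where f: "inj_on f (points Z)"
    using short_exact_carrier_embeds[OF X Z ex] by blast
  define h where "h = inv_into (points Z) f"
  have h: "h (f z) = z" if "z \<in> points Z" for z
    using that f by (simp add: h_def)
  note simps = Z.transport_simps[OF f] h Z.add_closed Z.scale_closed Z.zero_closed
  have i: "i y \<in> points Z" if "y \<in> points Y" for y
    using ex that by (auto simp: short_exact_def bounded_operator_def)
  have "short_exact Y (f \<circ> i) (transport f Z) (q \<circ> h) X"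
    unfolding short_exact_def
  proof (intro conjI)
    show "bounded_operator Y (transport f Z) (f \<circ> i)"
      using ex i by (auto simp: short_exact_def bounded_operator_def simps)
    show "bounded_operator (transport f Z) X (q \<circ> h)"
      using ex by (auto simp: short_exact_def bounded_operator_def simps)
    show "inj_on (f \<circ> i) (points Y)"
      using ex i f by (auto simp: short_exact_def intro!: comp_inj_on elim: inj_on_subset)
    show "(f \<circ> i) ` points Y = {z \<in> points (transport f Z). (q \<circ> h) z = vzero X}"
    proof -
      have Y: "i ` points Y = {z \<in> points Z. q z = vzero X}"
        using ex by (simp add: short_exact_def)
      have "(f \<circ> i) ` points Y = f ` {z \<in> points Z. q z = vzero X}"
        by (simp only: image_comp[symmetric] Y)
      then show ?thesis
        by (auto simp: simps)
    qed
    have "(q \<circ> h) ` points (transport f Z) = q ` points Z"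
      unfolding simps(1) image_image o_apply using h by (intro image_cong) auto
    then show "(q \<circ> h) ` points (transport f Z) = points X"
      using ex by (simp add: short_exact_def)
  qed
  then have "complemented (transport f Z) ((f \<circ> i) ` points Y)"
    using Ext Z.banach_structure_transport[OF f] unfolding Ext_zero_def by blast
  then obtain P where P: "bounded_operator (transport f Z) (transport f Z) P"
    "\<forall>x\<in>points (transport f Z). P (P x) = P x"
    "P ` points (transport f Z) = (f \<circ> i) ` points Y"
    by (auto simp: complemented_def)
  have Pf: "f (h (P (f z))) = P (f z)" "h (P (f z)) \<in> points Z" if "z \<in> points Z" for z
  proof -
    have "P (f z) \<in> f ` points Z"
      using P(1) that by (auto simp: bounded_operator_def simps)
    then show "f (h (P (f z))) = P (f z)" "h (P (f z)) \<in> points Z"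
      by (auto simp: simps)
  qed
  define R where "R = h \<circ> P \<circ> f"
  have R: "R z \<in> points Z" "P (f z) = f (R z)" if "z \<in> points Z" for z
    using Pf[OF that] by (simp_all add: R_def)
  have "bounded_operator Z Z R"
    unfolding bounded_operator_def
  proof (intro conjI ballI allI)
    show "R ` points Z \<subseteq> points Z" using R by blast
    fix x y assume xy: "x \<in> points Z" "y \<in> points Z"
    have "f (R (vadd Z x y)) = P (vadd (transport f Z) (f x) (f y))"
      using xy R by (simp add: simps)
    also have "\<dots> = vadd (transport f Z) (P (f x)) (P (f y))"
      using P(1) xy by (simp add: bounded_operator_def simps)
    also have "\<dots> = f (vadd Z (R x) (R y))"
      using xy R by (simp add: simps)
    finally show "R (vadd Z x y) = vadd Z (R x) (R y)"
      using inj_onD[OF f] xy R by (simp add: simps)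
  next
    fix a x assume x: "x \<in> points Z"
    have "f (R (vscale Z a x)) = P (vscale (transport f Z) a (f x))"
      using x R by (simp add: simps)
    also have "\<dots> = vscale (transport f Z) a (P (f x))"
      using P(1) x by (simp add: bounded_operator_def simps)
    also have "\<dots> = f (vscale Z a (R x))"
      using x R by (simp add: simps)
    finally show "R (vscale Z a x) = vscale Z a (R x)"
      using inj_onD[OF f] x R by (simp add: simps)
  next
    show "\<exists>C. \<forall>x\<in>points Z. vnorm Z (R x) \<le> C * vnorm Z x"
      using P(1) R by (auto simp: bounded_operator_def simps)
  qed
  moreover have "\<forall>x\<in>points Z. R (R x) = R x"
    using P(2) R h by (metis Z.transport_simps(1)[OF f] imageI)
  moreover have "R ` points Z = i ` points Y"
  proof -
    have "R ` points Z = h ` P ` points (transport f Z)"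
      by (simp add: R_def simps image_comp o_assoc)
    also have "\<dots> = i ` points Y"
      unfolding P(3) image_image o_apply using i h by (intro image_cong) auto
    finally show ?thesis .
  qed
  ultimately show ?thesis
    by (auto simp: complemented_def)
qed


section \<open>The spaces\<close>

text \<open>
  Over a discrete index type, \<open>'i \<Rightarrow>\<^sub>C real\<close> is \<open>\<ell>\<^sub>\<infinity>('i)\<close> with the supremum norm; in
  particular, \<open>nat \<Rightarrow>\<^sub>C real\<close> is \<open>\<ell>\<^sub>\<infinity>\<close>.
\<close>

definition c0 :: "('i::discrete_topology \<Rightarrow>\<^sub>C real) set" where
  "c0 = {x. \<forall>e>0. finite {k. e \<le> \<bar>apply_bcontfun x k\<bar>}}"

definition char_fun :: "'i set \<Rightarrow> ('i::discrete_topology \<Rightarrow>\<^sub>C real)" where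
  "char_fun A = Bcontfun (indicator A)"

lemma apply_char_fun [simp]: "char_fun A k = indicator A k"
proof -
  have "(indicator A :: 'a \<Rightarrow> real) \<in> bcontfun"
    by (rule bcontfun_normI[where b = 1]) (auto simp: indicator_def)
  then show ?thesis
    by (simp add: char_fun_def Bcontfun_inverse)
qed

definition JL_infty :: "('g \<Rightarrow> nat set) \<Rightarrow> 'g set \<Rightarrow> (nat \<Rightarrow>\<^sub>C real) set" where
  "JL_infty N \<Gamma> = closure (span (c0 \<union> (\<lambda>\<gamma>. char_fun (N \<gamma>)) ` \<Gamma>))"

text \<open>A discrete space with \<open>\<omega>\<^sub>1\<close> points: \<open>c\<^sub>0(\<omega>\<^sub>1)\<close> depends only on the index set.\<close>

typedef omega1 = "Field (cardSuc natLeq)"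
proof -
  have "infinite (Field (cardSuc natLeq))"
    using cardSuc_finite[OF natLeq_Card_order] by (simp add: Field_natLeq)
  then have "Field (cardSuc natLeq) \<noteq> {}" by auto
  then show ?thesis by blast
qed

lemma card_of_omega1: "(card_of (UNIV :: omega1 set), cardSuc natLeq) \<in> ordIso"
proof -
  have "bij_betw Rep_omega1 UNIV (Field (cardSuc natLeq))"
    by (simp add: bij_betw_def inj_on_def Rep_omega1_inject type_definition.Rep_range
        [OF type_definition_omega1])
  then have "(card_of (UNIV :: omega1 set), card_of (Field (cardSuc natLeq))) \<in> ordIso"
    using card_of_ordIso by blast
  then show ?thesis
    using card_of_Field_ordIso[OF cardSuc_Card_order[OF natLeq_Card_order]] ordIso_transitive
    by blast
qed

instantiation omega1 :: discrete_topology
begin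

definition open_omega1 :: "omega1 set \<Rightarrow> bool" where
  "open_omega1 U = True"

instance
  by standard (simp_all add: open_omega1_def)

end

abbreviation c0_omega1 :: "(omega1 \<Rightarrow>\<^sub>C real) set" where
  "c0_omega1 \<equiv> c0"

lemma subspace_c0: "subspace (c0 :: ('i::discrete_topology \<Rightarrow>\<^sub>C real) set)"
proof (rule subspaceI)
  fix x y :: "'i \<Rightarrow>\<^sub>C real" and a :: real
  assume x: "x \<in> c0"
  {
    assume y: "y \<in> c0"
    show "x + y \<in> c0"
      unfolding c0_def
    proof (intro CollectI allI impI)
      fix e :: real assume "0 < e"
      then have "finite ({k. e / 2 \<le> \<bar>x k\<bar>} \<union> {k. e / 2 \<le> \<bar>y k\<bar>})"
        using x y unfolding c0_def by (intro finite_UnI) (blast intro: half_gt_zero)+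
      then show "finite {k. e \<le> \<bar>(x + y) k\<bar>}"
        by (rule rev_finite_subset) auto
    qed
  }
  show "a *\<^sub>R x \<in> c0"
    unfolding c0_def
  proof (intro CollectI allI impI)
    fix e :: real assume e: "0 < e"
    show "finite {k. e \<le> \<bar>(a *\<^sub>R x) k\<bar>}"
    proof (cases "a = 0")
      case False
      then have "finite {k. e / \<bar>a\<bar> \<le> \<bar>x k\<bar>}"
        using x e by (simp add: c0_def)
      then show ?thesis
        using False by (simp add: abs_mult divide_le_eq mult.commute)
    qed (use e in simp)
  qed
qed (simp add: c0_def)

lemma closed_c0: "closed (c0 :: ('i::discrete_topology \<Rightarrow>\<^sub>C real) set)"
  unfolding closed_sequential_limits
proof safe
  fix f and l :: "'i \<Rightarrow>\<^sub>C real"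
  assume f: "\<forall>n. f n \<in> c0" and l: "f \<longlonglongrightarrow> l"
  show "l \<in> c0"
    unfolding c0_def
  proof (intro CollectI allI impI)
    fix e :: real assume e: "0 < e"
    then obtain n where n: "dist (f n) l < e / 2"
      using l unfolding lim_sequentially by (meson half_gt_zero order_refl)
    have "finite {k. e / 2 \<le> \<bar>f n k\<bar>}"
      using f e unfolding c0_def by (blast intro: half_gt_zero)
    moreover have "{k. e \<le> \<bar>l k\<bar>} \<subseteq> {k. e / 2 \<le> \<bar>f n k\<bar>}"
    proof
      fix k
      assume "k \<in> {k. e \<le> \<bar>l k\<bar>}"
      moreover have "\<bar>f n k - l k\<bar> < e / 2"
        using dist_fun_lt_imp_dist_val_lt[OF n, of k] by (simp add: dist_real_def)
      ultimately show "k \<in> {k. e / 2 \<le> \<bar>f n k\<bar>}"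
        by (simp add: abs_if field_simps split: if_splits)
    qed
    ultimately show "finite {k. e \<le> \<bar>l k\<bar>}"
      by (rule rev_finite_subset)
  qed
qed

lemma subspace_closure:
  fixes S :: "'a::real_normed_vector set"
  assumes "subspace S"
  shows "subspace (closure S)"
proof (rule subspaceI)
  show "0 \<in> closure S"
    using subspace_0[OF assms] closure_subset by blast
next
  fix x y assume "x \<in> closure S" "y \<in> closure S"
  then obtain u v where "\<And>n. u n \<in> S" "u \<longlonglongrightarrow> x" "\<And>n. v n \<in> S" "v \<longlonglongrightarrow> y"
    unfolding closure_sequential by blast
  then have "\<forall>n. u n + v n \<in> S" "(\<lambda>n. u n + v n) \<longlonglongrightarrow> x + y"
    using subspace_add[OF assms] by (auto intro: tendsto_add)
  then show "x + y \<in> closure S"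
    unfolding closure_sequential by (intro exI conjI)
next
  fix c x assume "x \<in> closure S"
  then obtain u where "\<And>n. u n \<in> S" "u \<longlonglongrightarrow> x"
    unfolding closure_sequential by blast
  then have "\<forall>n. c *\<^sub>R u n \<in> S" "(\<lambda>n. c *\<^sub>R u n) \<longlonglongrightarrow> c *\<^sub>R x"
    using subspace_scale[OF assms] by (auto intro: tendsto_scaleR)
  then show "c *\<^sub>R x \<in> closure S"
    unfolding closure_sequential by (intro exI conjI)
qed

lemma complete_bcontfun:
  fixes S :: "('i::discrete_topology \<Rightarrow>\<^sub>C real) set"
  assumes "closed S"
  shows "complete S"
proof (rule completeI)
  fix f :: "nat \<Rightarrow> 'i \<Rightarrow>\<^sub>C real"
  assume f: "\<forall>n. f n \<in> S" "Cauchy f"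
  then obtain g where "uniform_limit UNIV f g sequentially"
    using uniformly_convergent_eq_cauchy[of "\<lambda>_. True" f]
    unfolding Cauchy_def uniform_limit_sequentially_iff
    by (metis dist_fun_lt_imp_dist_val_lt)
  from uniform_limit_bcontfunE[OF this sequentially_bot]
  obtain l where "f \<longlonglongrightarrow> l" by metis
  then show "\<exists>l\<in>S. f \<longlonglongrightarrow> l"
    using closed_sequentially[OF assms] f by blast
qed

lemma banach_structure_c0_omega1: "banach_structure (of_subspace c0_omega1)"
  by (rule banach_structure_of_subspace[OF subspace_c0 complete_bcontfun[OF closed_c0]])

lemma banach_structure_JL_infty: "banach_structure (of_subspace (JL_infty N \<Gamma>))"
  unfolding JL_infty_def
  by (rule banach_structure_of_subspace[OF subspace_closure[OF subspace_span]
        complete_bcontfun[OF closed_closure]])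

end

theory Submission
  imports Defs
begin

text \<open>
  Choose \<open>\<omega>\<^sub>1\<close> many of the sets \<open>N\<^sub>\<gamma>\<close> and split each of them into two infinite halves. Let \<open>Z\<close> be
  the closed subspace of \<open>\<ell>\<^sub>\<infinity>\<close> spanned by \<open>JL\<^sub>\<infinity>\<close> and the indicators of the first halves. Sending
  \<open>f \<in> Z\<close> to the differences of its limits along the two halves maps \<open>Z\<close> onto \<open>c\<^sub>0(\<omega>\<^sub>1)\<close> with kernel
  \<open>JL\<^sub>\<infinity>\<close>. If this extension split, \<open>c\<^sub>0(\<omega>\<^sub>1)\<close> would embed into \<open>\<ell>\<^sub>\<infinity>\<close>; but every coordinate
  functional of \<open>\<ell>\<^sub>\<infinity>\<close> restricts to an element of \<open>\<ell>\<^sub>1(\<omega>\<^sub>1)\<close>, so all of them vanish at all but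
  countably many unit vectors.
\<close>

section \<open>Bounded functions on discrete sets, convergence, spans and summability\<close>

lemma Bcontfun_discrete:
  fixes g :: "'i::discrete_topology \<Rightarrow> real"
  assumes "\<And>k. \<bar>g k\<bar> \<le> C"
  shows "apply_bcontfun (Bcontfun g) = g"
proof -
  have "continuous_on UNIV g"
    by (simp add: continuous_on_open_invariant open_discrete)
  then have "g \<in> bcontfun"
    using assms by (intro bcontfun_normI[where b = C]) auto
  then show ?thesis
    by (simp add: Bcontfun_inverse)
qed

lemma apply_bcontfun_sum: "apply_bcontfun (\<Sum>i\<in>F. f i) x = (\<Sum>i\<in>F. apply_bcontfun (f i) x)"
  by (induction F rule: infinite_finite_induct) auto

lemma c0_if_finite_support:
  assumes "finite {k. apply_bcontfun x k \<noteq> 0}"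
  shows "x \<in> c0"
  unfolding c0_def
  by (auto intro: finite_subset[OF _ assms])

text \<open>A three-epsilon argument: the common Lipschitz constant carries the Cauchy property from
  a nearby \<open>f m\<close> over to \<open>l\<close>. This will make the domain of the quotient
  map closed.\<close>

lemma closed_convergent_lipschitz:
  fixes u :: "nat \<Rightarrow> 'a::metric_space \<Rightarrow> 'b::complete_space"
  assumes "\<And>n. C-lipschitz_on UNIV (u n)"
  shows "closed {f. convergent (\<lambda>n. u n f)}"
  unfolding closed_sequential_limits
proof safe
  fix f and l :: 'a
  assume f: "\<forall>m. f m \<in> {f. convergent (\<lambda>n. u n f)}" and l: "f \<longlonglongrightarrow> l"
  have C: "0 \<le> C" using lipschitz_on_nonneg[OF assms] .
  have "Cauchy (\<lambda>n. u n l)"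
  proof (rule metric_CauchyI)
    fix e :: real assume e: "0 < e"
    \<comment> \<open>The constant \<open>C\<close> may be 0; adding 1 keeps the quotient well
      defined.\<close>
    then have "0 < e / (3 * (C + 1))" using C by simp
    then obtain m where "dist (f m) l < e / (3 * (C + 1))"
      using l unfolding lim_sequentially by blast
    then have "(C + 1) * dist (f m) l < e / 3"
      using C by (simp add: field_simps)
    moreover have "dist (u n (f m)) (u n l) \<le> (C + 1) * dist (f m) l" for n
      by (rule order_trans[OF lipschitz_onD[OF assms UNIV_I UNIV_I]]) (simp add: mult_right_mono)
    ultimately have close: "dist (u n (f m)) (u n l) < e / 3" for n
      using le_less_trans by blast
    have "Cauchy (\<lambda>n. u n (f m))"
      using f by (simp add: convergent_Cauchy)
    then obtain M where M: "\<forall>i\<ge>M. \<forall>j\<ge>M. dist (u i (f m)) (u j (f m)) < e / 3"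
      using e unfolding Cauchy_def by (meson divide_pos_pos zero_less_numeral)
    have "dist (u i l) (u j l) < e" if "i \<ge> M" "j \<ge> M" for i j
    proof -
      have "dist (u i l) (u j l)
          \<le> dist (u i (f m)) (u i l) + dist (u i (f m)) (u j (f m)) + dist (u j (f m)) (u j l)"
        by metric
      also have "\<dots> < e / 3 + e / 3 + e / 3"
        using close M that by (intro add_strict_mono) auto
      finally show ?thesis by simp
    qed
    then show "\<exists>M. \<forall>i\<ge>M. \<forall>j\<ge>M. dist (u i l) (u j l) < e" by blast
  qed
  then show "convergent (\<lambda>n. u n l)"
    by (rule Cauchy_convergent)
qed

text \<open>Blocks of the series are dominated by blocks of the series of norms. Only the Cauchy
  property is stated, because the limit will be taken inside a complete carrier.\<close>

lemma Cauchy_partial_sums_if_summable_norm: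
  fixes f :: "nat \<Rightarrow> 'a::real_normed_vector"
  assumes "summable (\<lambda>n. norm (f n))"
  shows "Cauchy (\<lambda>n. \<Sum>k<n. f k)"
proof (rule CauchyI')
  fix e :: real assume "0 < e"
  then obtain M where M: "\<And>m n. m \<ge> M \<Longrightarrow> norm (\<Sum>k=m..<n. norm (f k)) < e"
    using assms unfolding summable_Cauchy by blast
  have "norm ((\<Sum>k<m. f k) - (\<Sum>k<n. f k)) < e" if "m \<ge> M" "n > m" for m n
  proof -
    have "(\<Sum>k<n. f k) - (\<Sum>k<m. f k) = (\<Sum>k=m..<n. f k)"
      using that(2) sum_diff_nat_ivl[of 0 m n f] by (simp add: atLeast0LessThan)
    then have "norm ((\<Sum>k<m. f k) - (\<Sum>k<n. f k)) \<le> (\<Sum>k=m..<n. norm (f k))"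
      by (metis norm_minus_commute norm_sum)
    then show ?thesis using M[OF that(1), of n] by simp
  qed
  then show "\<exists>M. \<forall>m\<ge>M. \<forall>n>m. dist (\<Sum>k<m. f k) (\<Sum>k<n. f k) < e"
    unfolding dist_norm by blast
qed

lemma span_image_explicit:
  assumes "y \<in> span (f ` I)"
  obtains F c where "finite F" "F \<subseteq> I" "y = (\<Sum>i\<in>F. c i *\<^sub>R f i)"
proof -
  obtain T r where T: "finite T" "T \<subseteq> f ` I" "y = (\<Sum>v\<in>T. r v *\<^sub>R v)"
    using assms unfolding span_explicit by blast
  \<comment> \<open>One index is chosen for each vector of \<open>T\<close>, so that the sum over
    vectors can be reindexed as a sum over indices.\<close>
  then obtain F where F: "F \<subseteq> I" "inj_on f F" "T = f ` F"
    using subset_image_inj[of T f I] by blast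
  have "y = (\<Sum>i\<in>F. r (f i) *\<^sub>R f i)"
    using T F by (simp add: sum.reindex)
  moreover have "finite F"
    using T F by (simp add: finite_image_iff)
  ultimately show ?thesis
    using that F by metis
qed

text \<open>Bounded finite sums make the family absolutely summable, and a summable family has only
  countably many nonzero terms.\<close>

lemma countable_support_if_finite_sums_bounded:
  fixes z :: "'i \<Rightarrow> real"
  assumes "\<And>F. finite F \<Longrightarrow> (\<Sum>i\<in>F. \<bar>z i\<bar>) \<le> C"
  shows "countable {i. z i \<noteq> 0}"
proof -
  have "(\<lambda>i. norm (z i)) summable_on UNIV"
    by (rule nonneg_bdd_above_summable_on) (auto intro: bdd_aboveI2[where M = C] assms)
  then show ?thesis
    using summable_countable_real[of "\<lambda>i. norm (z i)" UNIV] by simp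
qed

section \<open>Combinations of indicators of disjoint and almost disjoint sets\<close>

text \<open>At each point at most one summand survives.\<close>

lemma sum_disjoint_indicators_le:
  fixes c :: "'i \<Rightarrow> real"
  assumes "finite F" "\<And>i. i \<in> F \<Longrightarrow> \<bar>c i\<bar> \<le> e" "0 \<le> e" "disjoint_family_on D F"
  shows "\<bar>\<Sum>i\<in>F. c i * indicator (D i) k\<bar> \<le> e"
proof (cases "\<exists>i\<in>F. k \<in> D i")
  case True
  then obtain i where i: "i \<in> F" "k \<in> D i" by blast
  then have "k \<notin> D j" if "j \<in> F - {i}" for j
    using assms(4) that unfolding disjoint_family_on_def by blast
  then have "(\<Sum>j\<in>F - {i}. c j * indicator (D j) k) = 0"
    by (intro sum.neutral) simp
  then have "(\<Sum>j\<in>F. c j * indicator (D j) k) = c i"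
    using i assms(1) by (simp only: sum.remove[of F i]) simp
  then show ?thesis using i assms(2) by simp
next
  case False
  then have "(\<Sum>i\<in>F. c i * indicator (D i) k) = 0"
    by (intro sum.neutral) auto
  then show ?thesis using assms(3) by simp
qed

text \<open>Removing the finitely many pairwise intersections makes the sets disjoint.\<close>

lemma almost_disjoint_combination_mod_c0:
  fixes A :: "'i \<Rightarrow> 'k::discrete_topology set"
  assumes F: "finite F" and c: "\<And>i. i \<in> F \<Longrightarrow> \<bar>c i\<bar> \<le> e" "0 \<le> e"
    and A: "\<And>i j. \<lbrakk>i \<in> F; j \<in> F; i \<noteq> j\<rbrakk> \<Longrightarrow> finite (A i \<inter> A j)"
  obtains f where "norm f \<le> e" "f - (\<Sum>i\<in>F. c i *\<^sub>R char_fun (A i)) \<in> c0"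
proof -
  define E where "E = (\<Union>i\<in>F. \<Union>j\<in>F - {i}. A i \<inter> A j)"
  have E: "finite E"
    using F A unfolding E_def by blast
  define f where "f = (\<Sum>i\<in>F. c i *\<^sub>R char_fun (A i - E))"
  have "disjoint_family_on (\<lambda>i. A i - E) F"
    unfolding disjoint_family_on_def E_def by blast
  then have "\<bar>apply_bcontfun f k\<bar> \<le> e" for k
    using sum_disjoint_indicators_le[of F c e "\<lambda>i. A i - E" k] F c
    by (simp add: f_def apply_bcontfun_sum)
  then have "norm f \<le> e"
    by (intro norm_bound) simp
  moreover have "f - (\<Sum>i\<in>F. c i *\<^sub>R char_fun (A i)) \<in> c0"
  proof (rule c0_if_finite_support)
    have "apply_bcontfun (f - (\<Sum>i\<in>F. c i *\<^sub>R char_fun (A i))) k = 0" if "k \<notin> E" for k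
      using that by (simp add: f_def apply_bcontfun_sum indicator_def)
    then show "finite {k. apply_bcontfun (f - (\<Sum>i\<in>F. c i *\<^sub>R char_fun (A i))) k \<noteq> 0}"
      by (intro finite_subset[OF _ E]) auto
  qed
  ultimately show ?thesis using that by blast
qed

section \<open>Limits along injective sequences\<close>

text \<open>By injectivity, \<open>s\<close> visits the finite set \<open>S \<inter> range s\<close>
  only finitely often.\<close>

lemma indicator_along_almost_disjoint:
  assumes "inj s" "finite (S \<inter> range s)"
  shows "(\<lambda>n::nat. indicator S (s n) :: real) \<longlonglongrightarrow> 0"
proof (rule tendsto_eventually)
  have "finite (s -` (S \<inter> range s))"
    using assms by (intro finite_vimageI)
  moreover have "{n. \<not> indicator S (s n) = (0::real)} = s -` (S \<inter> range s)"
    by (auto simp: indicator_def)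
  ultimately show "\<forall>\<^sub>F n in sequentially. indicator S (s n) = (0::real)"
    by (simp add: eventually_cofinite flip: cofinite_eq_sequentially)
qed

lemma c0_along_inj:
  assumes "x \<in> c0" "inj s"
  shows "(\<lambda>n::nat. apply_bcontfun x (s n)) \<longlonglongrightarrow> 0"
  unfolding tendsto_iff
proof (intro allI impI)
  fix e :: real assume "0 < e"
  then have "finite (s -` {k. e \<le> \<bar>apply_bcontfun x k\<bar>})"
    using assms by (intro finite_vimageI) (auto simp: c0_def)
  then show "\<forall>\<^sub>F n in sequentially. dist (apply_bcontfun x (s n)) 0 < e"
    by (simp add: eventually_cofinite not_less vimage_def flip: cofinite_eq_sequentially)
qed

section \<open>Jump limits along two halves and the quotient map they define\<close>

text \<open>The sequences \<open>a i\<close> and \<open>b i\<close> enumerate the two halves of \<open>N (h i)\<close>.\<close>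

locale split_family =
  fixes N :: "'g \<Rightarrow> nat set" and \<Gamma> :: "'g set"
    and h :: "'i::discrete_topology \<Rightarrow> 'g" and a b :: "'i \<Rightarrow> nat \<Rightarrow> nat"
  assumes almost_disjoint: "\<lbrakk>\<gamma> \<in> \<Gamma>; \<delta> \<in> \<Gamma>; \<gamma> \<noteq> \<delta>\<rbrakk> \<Longrightarrow> finite (N \<gamma> \<inter> N \<delta>)"
    and h_in: "h i \<in> \<Gamma>" and inj_h: "inj h"
    and inj_a: "inj (a i)" and inj_b: "inj (b i)"
    and a_in: "a i n \<in> N (h i)" and b_in: "b i n \<in> N (h i)"
    and a_neq_b: "a i m \<noteq> b i n"
begin

definition jump :: "'i \<Rightarrow> nat \<Rightarrow> (nat \<Rightarrow>\<^sub>C real) \<Rightarrow> real" where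
  "jump i n f = apply_bcontfun f (a i n) - apply_bcontfun f (b i n)"

definition jump_convergent :: "(nat \<Rightarrow>\<^sub>C real) set" where
  "jump_convergent = {f. \<forall>i. convergent (\<lambda>n. jump i n f)}"

text \<open>The value of \<open>lim\<close> is meaningful only for convergent sequences, so all
  facts about \<open>quot\<close> are stated on \<open>jump_convergent\<close>. The values are
  bounded families at first; that they lie in \<open>c0\<close> is shown later on
  \<open>JL_split\<close>.\<close>

definition quot :: "(nat \<Rightarrow>\<^sub>C real) \<Rightarrow> ('i \<Rightarrow>\<^sub>C real)" where
  "quot f = Bcontfun (\<lambda>i. lim (\<lambda>n. jump i n f))"

lemma jump_add: "jump i n (f + g) = jump i n f + jump i n g"
  and jump_scaleR: "jump i n (r *\<^sub>R f) = r * jump i n f"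
  by (simp_all add: jump_def algebra_simps)

lemma abs_jump_le: "\<bar>jump i n f\<bar> \<le> 2 * norm f"
  using norm_bounded[of f "a i n"] norm_bounded[of f "b i n"] unfolding jump_def by simp

lemma lipschitz_jump: "2-lipschitz_on UNIV (jump i n)"
proof (rule lipschitz_onI)
  fix f g
  have "dist (jump i n f) (jump i n g) = \<bar>jump i n (f - g)\<bar>"
    by (simp add: jump_def dist_real_def algebra_simps)
  then show "dist (jump i n f) (jump i n g) \<le> 2 * dist f g"
    using abs_jump_le[of i n "f - g"] by (simp add: dist_norm)
qed simp

lemma closed_jump_convergent: "closed jump_convergent"
proof -
  have "jump_convergent = (\<Inter>i. {f. convergent (\<lambda>n. jump i n f)})"
    unfolding jump_convergent_def by blast
  then show ?thesis
    using closed_convergent_lipschitz[OF lipschitz_jump] by (simp add: closed_INT)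
qed

lemma quot_LIMSEQ:
  assumes "f \<in> jump_convergent"
  shows "(\<lambda>n. jump i n f) \<longlonglongrightarrow> apply_bcontfun (quot f) i"
proof -
  have conv: "(\<lambda>n. jump j n f) \<longlonglongrightarrow> lim (\<lambda>n. jump j n f)" for j
    using assms by (simp add: jump_convergent_def convergent_LIMSEQ_iff)
  \<comment> \<open>The limits inherit the uniform bound on the jumps, so the family of limits is
    bounded and \<open>Bcontfun\<close> represents it faithfully.\<close>
  have "\<bar>lim (\<lambda>n. jump j n f)\<bar> \<le> 2 * norm f" for j
    using tendsto_rabs[OF conv] by (rule tendsto_upperbound) (simp_all add: abs_jump_le)
  then have "apply_bcontfun (quot f) i = lim (\<lambda>n. jump i n f)"
    unfolding quot_def by (subst Bcontfun_discrete) auto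
  then show ?thesis using conv by simp
qed

text \<open>Uniqueness of limits settles membership in the domain and the value of
  \<open>quot\<close> at once; all later computations of \<open>quot\<close> go through this
  rule.\<close>

lemma quot_eqI:
  assumes "\<And>i. (\<lambda>n. jump i n f) \<longlonglongrightarrow> apply_bcontfun x i"
  shows "f \<in> jump_convergent" "quot f = x"
proof -
  show "f \<in> jump_convergent"
    using assms unfolding jump_convergent_def convergent_def by blast
  then show "quot f = x"
    using assms LIMSEQ_unique[OF quot_LIMSEQ] by (intro bcontfun_eqI) blast
qed

lemma quot_add:
  assumes "f \<in> jump_convergent" "g \<in> jump_convergent"
  shows "f + g \<in> jump_convergent" "quot (f + g) = quot f + quot g"
proof -
  have "(\<lambda>n. jump i n (f + g)) \<longlonglongrightarrow> apply_bcontfun (quot f + quot g) i" for i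
    using tendsto_add[OF quot_LIMSEQ[OF assms(1)] quot_LIMSEQ[OF assms(2)]]
    by (simp add: jump_add)
  from quot_eqI[OF this] show "f + g \<in> jump_convergent" "quot (f + g) = quot f + quot g"
    by blast+
qed

lemma quot_scaleR:
  assumes "f \<in> jump_convergent"
  shows "r *\<^sub>R f \<in> jump_convergent" "quot (r *\<^sub>R f) = r *\<^sub>R quot f"
proof -
  have "(\<lambda>n. jump i n (r *\<^sub>R f)) \<longlonglongrightarrow> apply_bcontfun (r *\<^sub>R quot f) i" for i
    using tendsto_mult_left[OF quot_LIMSEQ[OF assms]] by (simp add: jump_scaleR)
  from quot_eqI[OF this]
  show "r *\<^sub>R f \<in> jump_convergent" "quot (r *\<^sub>R f) = r *\<^sub>R quot f"
    by blast+
qed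

lemma quot_zero: "0 \<in> jump_convergent" "quot 0 = 0"
  using quot_eqI[of 0 0] by (simp_all add: jump_def)

lemma quot_diff:
  assumes "f \<in> jump_convergent" "g \<in> jump_convergent"
  shows "f - g \<in> jump_convergent" "quot (f - g) = quot f - quot g"
  using quot_add[OF assms(1) quot_scaleR(1)[OF assms(2), of "-1"]]
    quot_scaleR(2)[OF assms(2), of "-1"] by simp_all

lemma norm_quot_le:
  assumes "f \<in> jump_convergent"
  shows "norm (quot f) \<le> 2 * norm f"
proof (rule norm_bound)
  fix i
  show "norm (apply_bcontfun (quot f) i) \<le> 2 * norm f"
    using tendsto_norm[OF quot_LIMSEQ[OF assms]]
    by (rule tendsto_upperbound) (simp_all add: abs_jump_le)
qed

lemma continuous_on_quot: "continuous_on jump_convergent quot"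
proof -
  have "2-lipschitz_on jump_convergent quot"
    using norm_quot_le quot_diff by (intro lipschitz_onI) (metis dist_norm, simp)
  then show ?thesis
    by (rule lipschitz_on_continuous_on)
qed

lemma closed_quot_vimage:
  assumes "closed S"
  shows "closed {f \<in> jump_convergent. quot f \<in> S}"
proof -
  have "closed (jump_convergent \<inter> quot -` S)"
    using continuous_on_quot closed_jump_convergent assms by (rule continuous_closed_preimage)
  moreover have "jump_convergent \<inter> quot -` S = {f \<in> jump_convergent. quot f \<in> S}"
    by blast
  ultimately show ?thesis by simp
qed

lemma subspace_quot_vimage:
  assumes "subspace S"
  shows "subspace {f \<in> jump_convergent. quot f \<in> S}"
  using assms by (intro subspaceI) (auto simp: quot_zero quot_add quot_scaleR
    subspace_0 subspace_add subspace_scale)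

text \<open>The preimage of a closed subspace under the continuous linear \<open>quot\<close> is a
  closed subspace, so properties of \<open>quot\<close> need checking on generators only.\<close>

lemma closure_span_subset_quot_vimage:
  assumes "subspace S" "closed S" "\<And>f. f \<in> G \<Longrightarrow> f \<in> jump_convergent \<and> quot f \<in> S"
  shows "closure (span G) \<subseteq> {f \<in> jump_convergent. quot f \<in> S}"
  using assms by (intro closure_minimal span_minimal subspace_quot_vimage closed_quot_vimage) auto

section \<open>The quotient map on the generators\<close>

definition half :: "'i \<Rightarrow> nat \<Rightarrow>\<^sub>C real" where
  "half i = char_fun (range (a i))"

lemma finite_N_Int_range:
  assumes "\<gamma> \<in> \<Gamma>" "\<gamma> \<noteq> h i"
  shows "finite (N \<gamma> \<inter> range (a i))" "finite (N \<gamma> \<inter> range (b i))"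
proof -
  have "N \<gamma> \<inter> range (a i) \<subseteq> N \<gamma> \<inter> N (h i)" "N \<gamma> \<inter> range (b i) \<subseteq> N \<gamma> \<inter> N (h i)"
    using a_in b_in by auto
  then show "finite (N \<gamma> \<inter> range (a i))" "finite (N \<gamma> \<inter> range (b i))"
    using almost_disjoint[OF assms(1) h_in assms(2)] finite_subset by blast+
qed

lemma finite_halves:
  assumes "j \<noteq> i"
  shows "finite (range (a j) \<inter> range (a i))" "finite (range (a j) \<inter> range (b i))"
proof -
  have "range (a j) \<subseteq> N (h j)" "h j \<noteq> h i"
    using a_in assms inj_h by (auto dest: injD)
  then show "finite (range (a j) \<inter> range (a i))" "finite (range (a j) \<inter> range (b i))"
    using finite_N_Int_range[OF h_in] by (meson Int_mono finite_subset order_refl)+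
qed

lemma quot_c0:
  assumes "f \<in> c0"
  shows "f \<in> jump_convergent" "quot f = 0"
proof -
  have "(\<lambda>n. jump i n f) \<longlonglongrightarrow> apply_bcontfun 0 i" for i
    using tendsto_diff[OF c0_along_inj[OF assms inj_a] c0_along_inj[OF assms inj_b]]
    by (simp add: jump_def)
  from quot_eqI[OF this] show "f \<in> jump_convergent" "quot f = 0"
    by blast+
qed

text \<open>For \<open>\<gamma> = h i\<close> the indicator is 1 along both halves and the jump
  cancels; for other indices almost disjointness makes both limits 0.\<close>

lemma quot_char_fun_N:
  assumes "\<gamma> \<in> \<Gamma>"
  shows "char_fun (N \<gamma>) \<in> jump_convergent" "quot (char_fun (N \<gamma>)) = 0"
proof -
  have "(\<lambda>n. jump i n (char_fun (N \<gamma>))) \<longlonglongrightarrow> apply_bcontfun 0 i" for i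
  proof (cases "\<gamma> = h i")
    case True
    then show ?thesis by (simp add: jump_def a_in b_in)
  next
    case False
    then show ?thesis
      using tendsto_diff[OF
          indicator_along_almost_disjoint[OF inj_a finite_N_Int_range(1)[OF assms False]]
          indicator_along_almost_disjoint[OF inj_b finite_N_Int_range(2)[OF assms False]]]
      by (simp add: jump_def)
  qed
  from quot_eqI[OF this]
  show "char_fun (N \<gamma>) \<in> jump_convergent" "quot (char_fun (N \<gamma>)) = 0"
    by blast+
qed

text \<open>Along its own two halves the indicator is 1 and 0, so the jump is 1; along the halves
  for any other index it is eventually 0.\<close>

lemma quot_half: "half i \<in> jump_convergent" "quot (half i) = char_fun {i}"
proof -
  have "(\<lambda>n. jump j n (half i)) \<longlonglongrightarrow> apply_bcontfun (char_fun {i}) j" for j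
  proof (cases "i = j")
    case True
    moreover have "b i n \<notin> range (a i)" for n
      using a_neq_b by (metis imageE)
    ultimately show ?thesis by (simp add: jump_def half_def)
  next
    case False
    then show ?thesis
      using tendsto_diff[OF
          indicator_along_almost_disjoint[OF inj_a finite_halves(1)[OF False]]
          indicator_along_almost_disjoint[OF inj_b finite_halves(2)[OF False]]]
      by (simp add: jump_def half_def)
  qed
  from quot_eqI[OF this] show "half i \<in> jump_convergent" "quot (half i) = char_fun {i}"
    by blast+
qed

text \<open>For infinite \<open>F\<close> all the sums are 0 by convention.\<close>

lemma quot_sum_half:
  "(\<Sum>i\<in>F. c i *\<^sub>R half i) \<in> jump_convergent"
  "quot (\<Sum>i\<in>F. c i *\<^sub>R half i) = (\<Sum>i\<in>F. c i *\<^sub>R char_fun {i})"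
  by (induction F rule: infinite_finite_induct)
    (auto simp: quot_zero quot_add quot_scaleR quot_half)

lemma apply_sum_char_fun_singleton:
  "finite F \<Longrightarrow> apply_bcontfun (\<Sum>i\<in>F. c i *\<^sub>R char_fun {i}) j = (if j \<in> F then c j else 0)"
  by (simp add: apply_bcontfun_sum indicator_def if_distrib cong: if_cong)

text \<open>The first halves are again almost disjoint. Modulo \<open>c0\<close>, a combination of
  them is thus as small as its largest coefficient, which drives the kernel, lifting and
  non-splitting arguments.\<close>

lemma half_combination_mod_c0:
  assumes "finite F" "\<And>i. i \<in> F \<Longrightarrow> \<bar>c i\<bar> \<le> e" "0 \<le> e"
  obtains f where "norm f \<le> e" "f - (\<Sum>i\<in>F. c i *\<^sub>R half i) \<in> c0"
  using almost_disjoint_combination_mod_c0[of F c e "\<lambda>i. range (a i)"] assms finite_halves(1)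
  unfolding half_def by blast

section \<open>The middle term of the extension\<close>

definition JL_gens :: "(nat \<Rightarrow>\<^sub>C real) set" where
  "JL_gens = c0 \<union> (\<lambda>\<gamma>. char_fun (N \<gamma>)) ` \<Gamma>"

definition JL_split :: "(nat \<Rightarrow>\<^sub>C real) set" where
  "JL_split = closure (span (JL_gens \<union> range half))"

lemma JL_infty_eq: "JL_infty N \<Gamma> = closure (span JL_gens)"
  by (simp add: JL_infty_def JL_gens_def)

lemma JL_infty_subset: "JL_infty N \<Gamma> \<subseteq> JL_split"
  unfolding JL_infty_eq JL_split_def by (intro closure_mono span_mono) simp

lemma subspace_JL_split: "subspace JL_split"
  unfolding JL_split_def by (intro subspace_closure subspace_span)

lemma subspace_JL_infty: "subspace (JL_infty N \<Gamma>)"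
  unfolding JL_infty_eq by (intro subspace_closure subspace_span)

lemma c0_subset_JL_infty: "c0 \<subseteq> JL_infty N \<Gamma>"
  unfolding JL_infty_eq JL_gens_def by (meson closure_subset le_sup_iff order_trans span_superset)

lemma half_in_JL_split: "half i \<in> JL_split"
  unfolding JL_split_def by (meson Un_iff closure_subset rangeI span_superset subsetD)

lemma sum_half_in_JL_split: "(\<Sum>i\<in>F. c i *\<^sub>R half i) \<in> JL_split"
  by (intro subspace_sum subspace_scale subspace_JL_split half_in_JL_split)

lemma quot_gens:
  assumes "f \<in> JL_gens"
  shows "f \<in> jump_convergent \<and> quot f = 0"
  using assms quot_c0 quot_char_fun_N by (auto simp: JL_gens_def)

lemma quot_JL_infty:
  assumes "f \<in> JL_infty N \<Gamma>"
  shows "f \<in> jump_convergent" "quot f = 0"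
  using closure_span_subset_quot_vimage[of "{0}" JL_gens] quot_gens assms
  by (auto simp: JL_infty_eq subspace_single_0)

lemma quot_JL_split:
  assumes "f \<in> JL_split"
  shows "f \<in> jump_convergent" "quot f \<in> c0"
proof -
  have "char_fun {i} \<in> c0" for i :: 'i
    by (rule c0_if_finite_support) (simp add: indicator_def)
  then have "JL_split \<subseteq> {f \<in> jump_convergent. quot f \<in> c0}"
    unfolding JL_split_def
    using quot_gens quot_half subspace_0[OF subspace_c0]
    by (intro closure_span_subset_quot_vimage subspace_c0 closed_c0) auto
  then show "f \<in> jump_convergent" "quot f \<in> c0"
    using assms by auto
qed

section \<open>The kernel of the quotient map\<close>

text \<open>Approximate \<open>f\<close> by \<open>x + y\<close> with \<open>x\<close> from the
  generators of the kernel and \<open>y\<close> a combination of halves. The coefficients of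
  \<open>y\<close> are the values of \<open>quot (x + y)\<close>, which are small, so
  \<open>y\<close> is small modulo \<open>c0\<close> and can be traded away.\<close>

lemma quot_kernel:
  assumes f: "f \<in> JL_split" "quot f = 0"
  shows "f \<in> JL_infty N \<Gamma>"
  unfolding JL_infty_eq closure_approachable
proof (intro allI impI)
  fix e :: real assume e: "0 < e"
  \<comment> \<open>The final error is below \<open>e / 3\<close> from \<open>g\<close> plus at most
    \<open>2 * (e / 3)\<close> from \<open>k\<close>; the factor 2 is the bound on
    \<open>quot\<close>.\<close>
  then have "0 < e / 3" by simp
  then obtain g where g: "g \<in> span (JL_gens \<union> range half)" "dist g f < e / 3"
    using f(1) unfolding JL_split_def closure_approachable by blast
  then obtain x y where xy: "g = x + y" "x \<in> span JL_gens" "y \<in> span (range half)"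
    unfolding span_Un by blast
  from xy(3) obtain F c where F: "finite F" and y: "y = (\<Sum>i\<in>F. c i *\<^sub>R half i)"
    by (rule span_image_explicit)
  have xJ: "x \<in> JL_infty N \<Gamma>"
    using xy(2) closure_subset unfolding JL_infty_eq by blast
  have fW: "f \<in> jump_convergent"
    using quot_JL_split f by blast
  have "g \<in> jump_convergent" "quot g = (\<Sum>i\<in>F. c i *\<^sub>R char_fun {i})"
    using quot_add quot_JL_infty[OF xJ] quot_sum_half by (simp_all add: xy(1) y)
  \<comment> \<open>As \<open>quot f = 0\<close>, the left side is the norm of
    \<open>quot (g - f)\<close>.\<close>
  then have "norm (\<Sum>i\<in>F. c i *\<^sub>R char_fun {i} :: 'i \<Rightarrow>\<^sub>C real) \<le> 2 * norm (g - f)"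
    using norm_quot_le[OF quot_diff(1)[of g f]] quot_diff(2)[of g f] fW f(2) by simp
  then have n: "norm (\<Sum>i\<in>F. c i *\<^sub>R char_fun {i} :: 'i \<Rightarrow>\<^sub>C real) \<le> 2 * (e / 3)"
    using g(2) by (simp add: dist_norm)
  have "\<bar>c i\<bar> \<le> 2 * (e / 3)" if "i \<in> F" for i
    using norm_bounded[of "\<Sum>i\<in>F. c i *\<^sub>R char_fun {i}" i] n that
    by (simp add: apply_sum_char_fun_singleton F)
  then obtain k where k: "norm k \<le> 2 * (e / 3)" "k - y \<in> c0"
    using half_combination_mod_c0[OF F, of c "2 * (e / 3)"] e unfolding y by auto
  \<comment> \<open>The vector \<open>x - (k - y)\<close> equals \<open>g - k\<close>, hence is
    close to \<open>f\<close>, while the halves in \<open>y\<close> enter only through an element of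
    \<open>c0\<close>.\<close>
  have "k - y \<in> span JL_gens"
    using k(2) by (auto simp: JL_gens_def intro: span_base)
  then have "x - (k - y) \<in> span JL_gens"
    by (rule span_diff[OF xy(2)])
  moreover have "dist (x - (k - y)) f < e"
  proof -
    have "x - (k - y) - f = (g - f) - k" by (simp add: xy(1))
    then have "norm (x - (k - y) - f) \<le> norm (g - f) + norm k"
      by (metis norm_triangle_ineq4)
    then show ?thesis using g(2) k(1) by (simp add: dist_norm)
  qed
  ultimately show "\<exists>y\<in>span JL_gens. dist y f < e" by blast
qed

section \<open>Surjectivity of the quotient map\<close>

text \<open>The obvious lift by halves may have large norm where they overlap; a correction in
  \<open>c0\<close> restores the norm of \<open>x\<close> and is invisible to
  \<open>quot\<close>.\<close>

lemma quot_lift_finite_support: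
  assumes "finite {i. apply_bcontfun x i \<noteq> 0}"
  obtains f where "f \<in> JL_split" "norm f \<le> norm x" "quot f = x"
proof -
  define F where "F = {i. apply_bcontfun x i \<noteq> 0}"
  define y where "y = (\<Sum>i\<in>F. apply_bcontfun x i *\<^sub>R half i)"
  have F: "finite F" using assms by (simp add: F_def)
  have "\<bar>apply_bcontfun x i\<bar> \<le> norm x" for i
    using norm_bounded[of x i] by simp
  then obtain f where f: "norm f \<le> norm x" "f - y \<in> c0"
    using half_combination_mod_c0[OF F, of "apply_bcontfun x" "norm x"] unfolding y_def by auto
  have "quot y = x"
    unfolding y_def quot_sum_half
    by (rule bcontfun_eqI) (simp add: apply_sum_char_fun_singleton F, simp add: F_def)
  moreover have "f = (f - y) + y" by simp
  ultimately have "quot f = x"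
    using quot_add(2)[OF quot_c0(1)[OF f(2)], of y] quot_c0(2)[OF f(2)] quot_sum_half(1)
    by (simp add: y_def)
  moreover have "f \<in> JL_split"
    using subspace_add[OF subspace_JL_split, of "f - y" y] f(2) c0_subset_JL_infty
      JL_infty_subset sum_half_in_JL_split by (auto simp: y_def)
  ultimately show ?thesis using that f(1) by blast
qed

text \<open>Slice the target dyadically by size, lift each finitely supported slice with control of
  the norm, and add up.\<close>

lemma quot_surj:
  assumes x: "x \<in> c0"
  obtains f where "f \<in> JL_split" "quot f = x"
proof -
  \<comment> \<open>\<open>G n\<close> holds the coordinates that first reach the threshold at level
    \<open>n\<close>, so the slices are disjoint.\<close>
  define S where "S n = {i. (1/2)^n \<le> \<bar>apply_bcontfun x i\<bar>}" for n :: nat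
  define G where "G n = S n - (\<Union>m<n. S m)" for n
  have finS: "finite (S n)" for n
    using x by (simp add: S_def c0_def)
  define d where "d n = (\<Sum>i\<in>G n. apply_bcontfun x i *\<^sub>R char_fun {i})" for n
  have G: "finite (G n)" for n using finS by (simp add: G_def)
  have d: "apply_bcontfun (d n) i = (if i \<in> G n then apply_bcontfun x i else 0)" for n i
    by (simp add: d_def apply_sum_char_fun_singleton G)
  \<comment> \<open>Level 0 is bounded by \<open>norm x\<close>; at a later level the failed
    previous threshold gives \<open>2 * (1/2)^n\<close>. The constant \<open>norm x + 2\<close>
    covers both cases.\<close>
  have nd: "norm (d n) \<le> (norm x + 2) * (1/2)^n" for n
  proof (rule norm_bound)
    fix i
    have "\<bar>apply_bcontfun x i\<bar> \<le> (norm x + 2) * (1/2)^n" if "i \<in> G n"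
    proof (cases n)
      case 0
      then show ?thesis using norm_bounded[of x i] by simp
    next
      case (Suc m)
      then have "\<bar>apply_bcontfun x i\<bar> < (1/2)^m"
        using that by (auto simp: G_def S_def not_le)
      also have "\<dots> = 2 * (1/2)^n"
        by (simp add: Suc)
      also have "\<dots> \<le> (norm x + 2) * (1/2)^n"
        by (intro mult_right_mono) auto
      finally show ?thesis by simp
    qed
    then show "norm (apply_bcontfun (d n) i) \<le> (norm x + 2) * (1/2)^n"
      by (simp add: d)
  qed
  have "finite {i. apply_bcontfun (d n) i \<noteq> 0}" for n
    using G[of n] by (rule finite_subset[rotated]) (auto simp: d split: if_splits)
  then have "\<exists>f. f \<in> JL_split \<and> norm f \<le> norm (d n) \<and> quot f = d n" for n
    using quot_lift_finite_support by metis
  then obtain f where f: "\<And>n. f n \<in> JL_split" "\<And>n. norm (f n) \<le> norm (d n)"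
    "\<And>n. quot (f n) = d n"
    by metis
  have sum_f: "(\<Sum>m<n. f m) \<in> JL_split" for n
    using f(1) by (intro subspace_sum subspace_JL_split)
  have quot_sum_f: "quot (\<Sum>m<n. f m) = (\<Sum>m<n. d m)" for n
    by (induction n) (use sum_f quot_JL_split(1) f in \<open>auto simp: quot_zero quot_add\<close>)
  have "summable (\<lambda>n. norm (f n))"
  proof (rule summable_comparison_test')
    show "summable (\<lambda>n. (norm x + 2) * (1/2)^n)"
      by (intro summable_mult summable_geometric) simp
    show "norm (norm (f n)) \<le> (norm x + 2) * (1/2)^n" if "n \<ge> 0" for n
      using f(2)[of n] nd[of n] by simp
  qed
  then have "Cauchy (\<lambda>n. \<Sum>m<n. f m)"
    by (rule Cauchy_partial_sums_if_summable_norm)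
  moreover have "complete JL_split"
    by (simp add: complete_bcontfun JL_split_def)
  ultimately obtain l where s: "l \<in> JL_split" and lim: "(\<lambda>n. \<Sum>m<n. f m) \<longlonglongrightarrow> l"
    using sum_f unfolding complete_def by meson
  \<comment> \<open>It suffices to compare coordinates: a nonzero coordinate of \<open>x\<close>
    occurs in exactly one slice, so its series has a single nonzero term.\<close>
  have "apply_bcontfun (quot l) i = apply_bcontfun x i" for i
  proof -
    have "(\<lambda>n. quot (\<Sum>m<n. f m)) \<longlonglongrightarrow> quot l"
      using quot_JL_split(1) sum_f s
      by (intro continuous_on_tendsto_compose[OF continuous_on_quot lim]) auto
    then have "(\<lambda>n. apply_bcontfun (\<Sum>m<n. d m) i) \<longlonglongrightarrow> apply_bcontfun (quot l) i"
      unfolding quot_sum_f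
      by (intro tendsto_uniform_limitI[OF tendsto_bcontfun_uniform_limit]) auto
    then have "(\<lambda>n. apply_bcontfun (d n) i) sums apply_bcontfun (quot l) i"
      by (simp add: sums_def apply_bcontfun_sum)
    moreover have "(\<lambda>n. apply_bcontfun (d n) i) sums apply_bcontfun x i"
    proof (cases "apply_bcontfun x i = 0")
      case True
      then have "(\<lambda>n. apply_bcontfun (d n) i) = (\<lambda>n. 0)" by (auto simp: d)
      then show ?thesis using True by simp
    next
      case False
      then obtain n where "(1/2)^n < \<bar>apply_bcontfun x i\<bar>"
        using real_arch_pow_inv[of "\<bar>apply_bcontfun x i\<bar>" "1/2"] by auto
      then have ex: "\<exists>n. i \<in> S n" by (auto simp: S_def intro: less_imp_le)
      define k where "k = (LEAST n. i \<in> S n)"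
      have k: "i \<in> S k"
        unfolding k_def using ex by (rule LeastI_ex)
      have k_le: "k \<le> m" if "i \<in> S m" for m
        unfolding k_def using that by (rule Least_le)
      have "i \<in> G n \<longleftrightarrow> i \<in> S n \<and> (\<forall>m<n. i \<notin> S m)" for n
        by (simp add: G_def Ball_def)
      then have "i \<in> G n \<longleftrightarrow> n = k" for n
        using k leD[OF k_le] by (cases k n rule: linorder_cases) auto
      then have "(\<lambda>n. apply_bcontfun (d n) i) = (\<lambda>n. if n = k then apply_bcontfun x i else 0)"
        by (auto simp: d)
      then show ?thesis using sums_single[of k "\<lambda>_. apply_bcontfun x i"] by simp
    qed
    ultimately show ?thesis by (rule sums_unique2)
  qed
  then show ?thesis using that s bcontfun_eqI by blast
qed

section \<open>The short exact sequence\<close>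

lemma banach_structure_JL_split: "banach_structure (of_subspace JL_split)"
  using subspace_JL_split
  by (rule banach_structure_of_subspace) (simp add: complete_bcontfun JL_split_def)

lemma short_exact_JL_split:
  "short_exact (of_subspace (JL_infty N \<Gamma>)) id (of_subspace JL_split) quot (of_subspace c0)"
  unfolding short_exact_def
proof (intro conjI)
  show "bounded_operator (of_subspace (JL_infty N \<Gamma>)) (of_subspace JL_split) id"
    using JL_infty_subset by (auto simp: bounded_operator_def of_subspace_def intro!: exI[of _ 1])
  show "bounded_operator (of_subspace JL_split) (of_subspace c0) quot"
    using quot_JL_split quot_add quot_scaleR norm_quot_le
    by (auto simp: bounded_operator_def of_subspace_def intro!: exI[of _ 2])
  show "id ` points (of_subspace (JL_infty N \<Gamma>))
      = {z \<in> points (of_subspace JL_split). quot z = vzero (of_subspace c0)}"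
    using quot_kernel quot_JL_infty JL_infty_subset by (auto simp: of_subspace_def)
  show "quot ` points (of_subspace JL_split) = points (of_subspace c0)"
  proof -
    have "c0 \<subseteq> quot ` JL_split"
      using quot_surj by (metis imageI subsetI)
    then have "quot ` JL_split = c0"
      using quot_JL_split(2) by blast
    then show ?thesis by (simp add: of_subspace_def)
  qed
qed simp

section \<open>A projection forces a countable index set\<close>

lemma complemented_imp_countable:
  assumes "complemented (of_subspace JL_split) (JL_infty N \<Gamma>)"
  shows "countable (UNIV :: 'i set)"
proof -
  obtain P where op: "bounded_operator (of_subspace JL_split) (of_subspace JL_split) P"
    and idem: "\<And>f. f \<in> JL_split \<Longrightarrow> P (P f) = P f" and range: "P ` JL_split = JL_infty N \<Gamma>"
    using assms unfolding complemented_def by (auto simp: of_subspace_def)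
  obtain C where C: "\<And>f. f \<in> JL_split \<Longrightarrow> norm (P f) \<le> C * norm f"
    using op that unfolding bounded_operator_def by (fastforce simp: of_subspace_def)
  have P: "P f \<in> JL_infty N \<Gamma>" if "f \<in> JL_split" for f
    using range that by blast
  have P_id: "P f = f" if "f \<in> JL_infty N \<Gamma>" for f
    using range idem that by (metis imageE)
  have P_add: "P (f + g) = P f + P g" if "f \<in> JL_split" "g \<in> JL_split" for f g
    using op that by (simp add: bounded_operator_def of_subspace_def)
  have P_scaleR: "P (r *\<^sub>R f) = r *\<^sub>R P f" if "f \<in> JL_split" for r f
    using op that by (simp add: bounded_operator_def of_subspace_def)
  have P_sum: "P (\<Sum>i\<in>F. c i *\<^sub>R half i) = (\<Sum>i\<in>F. c i *\<^sub>R P (half i))" for F c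
  proof (induction F rule: infinite_finite_induct)
    case (insert j F)
    then show ?case
      using P_add P_scaleR half_in_JL_split sum_half_in_JL_split subspace_scale[OF subspace_JL_split]
      by simp
  qed (use P_id subspace_0[OF subspace_JL_infty] in auto)
  \<comment> \<open>Since \<open>P\<close> fixes \<open>JL_infty N \<Gamma>\<close>, the map
    \<open>f - P f\<close> vanishes there; \<open>z i\<close> is the image of the unit vector at
    \<open>i\<close> under the induced section of \<open>quot\<close>.\<close>
  define z where "z i = half i - P (half i)" for i
  have bound: "(\<Sum>i\<in>F. \<bar>apply_bcontfun (z i) k\<bar>) \<le> 1 + \<bar>C\<bar>" if F: "finite F" for F k
  proof -
    \<comment> \<open>The signs turn the sum of absolute values into a single coordinate of
      \<open>f - P f\<close>.\<close>
    define c where "c i = sgn (apply_bcontfun (z i) k)" for i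
    define y where "y = (\<Sum>i\<in>F. c i *\<^sub>R half i)"
    \<comment> \<open>Overlaps may make \<open>y\<close> large. Passing to \<open>f\<close> changes
      it by an element of \<open>c0\<close>, on which \<open>f - P f\<close> vanishes, and keeps the
      norm at most 1.\<close>
    obtain f where f: "norm f \<le> 1" "f - y \<in> c0"
      using half_combination_mod_c0[OF F, of c 1] unfolding y_def
      by (auto simp: c_def abs_sgn_eq)
    have fy: "f - y \<in> JL_infty N \<Gamma>"
      using f(2) c0_subset_JL_infty by blast
    have y: "y \<in> JL_split"
      using sum_half_in_JL_split by (simp add: y_def)
    have fZ: "f \<in> JL_split"
      using subspace_add[OF subspace_JL_split, of "f - y" y] fy y JL_infty_subset by auto
    have "P f = (f - y) + P y"
      using P_id[OF fy] P_add[of "f - y" y] fy y JL_infty_subset by auto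
    then have "f - P f = (\<Sum>i\<in>F. c i *\<^sub>R z i)"
      using P_sum by (simp add: y_def z_def scaleR_diff_right sum_subtractf)
    then have "(\<Sum>i\<in>F. \<bar>apply_bcontfun (z i) k\<bar>) = apply_bcontfun (f - P f) k"
      by (simp add: apply_bcontfun_sum c_def abs_sgn mult.commute)
    also have "\<dots> \<le> norm (f - P f)"
      using norm_bounded[of "f - P f" k] by simp
    also have "\<dots> \<le> norm f + norm (P f)"
      by (rule norm_triangle_ineq4)
    also have "\<dots> \<le> 1 + \<bar>C\<bar>"
    proof -
      have "norm (P f) \<le> C * norm f" using C fZ .
      also have "\<dots> \<le> \<bar>C\<bar> * 1" using f(1) by (intro mult_mono) auto
      finally show ?thesis using f(1) by simp
    qed
    finally show ?thesis .
  qed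
  \<comment> \<open>Otherwise \<open>half i\<close> would lie in the kernel of \<open>quot\<close>,
    although its image is a unit vector.\<close>
  have "z i \<noteq> 0" for i
  proof
    assume "z i = 0"
    then have "half i \<in> JL_infty N \<Gamma>"
      using P[OF half_in_JL_split, of i] by (simp add: z_def)
    then have "apply_bcontfun (char_fun {i}) i = (0::real)"
      using quot_JL_infty(2) quot_half(2) by (metis zero_bcontfun.rep_eq)
    then show False by simp
  qed
  \<comment> \<open>Each nonzero \<open>z i\<close> has a nonzero coordinate, there are countably
    many coordinates, and each is nonzero for countably many \<open>i\<close>.\<close>
  then have "UNIV = (\<Union>k. {i. apply_bcontfun (z i) k \<noteq> 0})"
    by (auto simp: set_eq_iff) (metis bcontfun_eqI zero_bcontfun.rep_eq)
  moreover have "countable (\<Union>k. {i. apply_bcontfun (z i) k \<noteq> 0})"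
    using countable_support_if_finite_sums_bounded[OF bound] by (intro countable_UN) auto
  ultimately show ?thesis by simp
qed

end

section \<open>The first uncountable cardinal and the non-splitting theorem\<close>

unbundle cardinal_syntax

lemma uncountable_omega1: "uncountable (UNIV :: omega1 set)"
proof
  assume "countable (UNIV :: omega1 set)"
  then have "|UNIV :: omega1 set| \<le>o |UNIV :: nat set|"
    unfolding countable_def using card_of_ordLeq by blast
  then have "|UNIV :: omega1 set| \<le>o natLeq"
    using card_of_nat ordLeq_ordIso_trans by blast
  then have "cardSuc natLeq \<le>o natLeq"
    using card_of_omega1 ordIso_ordLeq_trans ordIso_symmetric by blast
  then show False
    using cardSuc_greater[OF natLeq_Card_order] not_ordLess_ordLeq by blast
qed

text \<open>The cardinal of \<open>\<Gamma>\<close> lies strictly above that of the naturals, hence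
  is at least its successor.\<close>

lemma omega1_embeds_uncountable:
  assumes "uncountable \<Gamma>"
  obtains h :: "omega1 \<Rightarrow> 'g" where "inj h" "range h \<subseteq> \<Gamma>"
proof -
  have "\<not> |\<Gamma>| \<le>o |UNIV :: nat set|"
    using assms unfolding countable_def card_of_ordLeq[symmetric] by auto
  then have "|UNIV :: nat set| <o |\<Gamma>|"
    using not_ordLeq_iff_ordLess[OF card_of_Well_order card_of_Well_order] by blast
  then have "natLeq <o |\<Gamma>|"
    using card_of_nat ordIso_ordLess_trans ordIso_symmetric by blast
  then have "cardSuc natLeq \<le>o |\<Gamma>|"
    using cardSuc_ordLess_ordLeq[OF natLeq_Card_order card_of_Card_order] by blast
  then have "|UNIV :: omega1 set| \<le>o |\<Gamma>|"
    using card_of_omega1 ordIso_ordLeq_trans by blast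
  then show ?thesis
    using that unfolding card_of_ordLeq[symmetric] by blast
qed

theorem proposition6p5:
  fixes N :: "'g \<Rightarrow> nat set" and \<Gamma> :: "'g set"
  assumes "uncountable \<Gamma>"
    and "\<And>\<gamma>. \<gamma> \<in> \<Gamma> \<Longrightarrow> infinite (N \<gamma>)"
    and "\<And>\<gamma> \<delta>. \<lbrakk>\<gamma> \<in> \<Gamma>; \<delta> \<in> \<Gamma>; \<gamma> \<noteq> \<delta>\<rbrakk> \<Longrightarrow> finite (N \<gamma> \<inter> N \<delta>)"
  shows "\<not> Ext_zero (of_subspace c0_omega1) (of_subspace (JL_infty N \<Gamma>))"
proof
  assume Ext: "Ext_zero (of_subspace c0_omega1) (of_subspace (JL_infty N \<Gamma>))"
  obtain h :: "omega1 \<Rightarrow> 'g" where h: "inj h" "range h \<subseteq> \<Gamma>"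
    using omega1_embeds_uncountable[OF assms(1)] .
  \<comment> \<open>The even and odd positions in the increasing enumeration give two disjoint
    infinite halves.\<close>
  define a b where "a i n = enumerate (N (h i)) (2 * n)"
    and "b i n = enumerate (N (h i)) (2 * n + 1)" for i n
  have inf: "infinite (N (h i))" for i
    using h assms(2) by blast
  then have enum: "enumerate (N (h i)) m = enumerate (N (h i)) n \<longleftrightarrow> m = n"
      "enumerate (N (h i)) n \<in> N (h i)" for i m n
    by (auto simp: enumerate_in_set strict_mono_eq[OF strict_mono_enumerate])
  interpret split_family N \<Gamma> h a b
  proof
    show "a i m \<noteq> b i n" for i m n
      unfolding a_def b_def enum by presburger
  qed (use h assms(3) in \<open>auto simp: a_def b_def enum inj_on_def\<close>)
  have "complemented (of_subspace JL_split) (id ` points (of_subspace (JL_infty N \<Gamma>)))"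
    using Ext_zero_complemented[OF banach_structure_c0_omega1 banach_structure_JL_split
        short_exact_JL_split Ext] .
  then show False
    using complemented_imp_countable uncountable_omega1 by (simp add: of_subspace_def)
qed

end
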